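(* Let $\alpha,\beta\in\mathbb{Q}$ be such that $p(x)=x^2+\alpha x+\beta$ is irreducible over $\mathbb{Q}$ and its companion matrix $A=\begin{bmatrix}0&-\beta\\1&-\alpha\end{bmatrix}$ is expanding (all eigenvalues have modulus $>1$). Let $c$ be the unique positive integer for which $cp(x)=cx^2+ax+b$ has coprime integer coefficients, $a=c\alpha$, $b=c\beta$. Let $\mathcal{D}=\{(0,0)^\top,(1,0)^\top,\dots,(|b|-1,0)^\top\}$ and let $\mathcal{A}_\Phi$ be the attractor of the dynamical system $\Phi$ induced by $(A,\mathcal{D})$. Then: 1. If $0<\alpha\le\beta-1$, then $\mathcal{A}_\Phi=\{0\}$. 2. If $0<-\alpha<\beta-1$ and $\alpha<-1$, then $\mathcal{A}_\Phi=\{(0,0)^\top,(a+c,c)^\top,2(a+c,c)^\top,\dots,K(a+c,c)^\top\}$, where $K$ is the largest positive integer such that $K(a+b+c)\le b-1$. 3. If $0<-\alpha<\beta-1$ and $\alpha\ge-1$, then $\mathcal{A}_\Phi=\{0\}$. 4. If $0<-\alpha<-\beta-1$, then $\mathcal{A}_\Phi$ contains $\{(0,0)^\top,-(a,c)^\top,-(c,0)^\top\}$. 5. If $0<\alpha<-\beta-1$, then $\mathcal{A}_\Phi$ contains $\{(0,0)^\top,-(a+c,c)^\top,\dots,-K(a+c,c)^\top\}$, where $K$ is the largest positive integer such that $K(-a-b-c)\le -b-1$.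
   Context: $\mathbb{Z}^2[A]=\bigcup_{k\ge0}(\mathbb{Z}^2+A\mathbb{Z}^2+\cdots+A^k\mathbb{Z}^2)$. The set $\mathcal{D}$ is a complete residue system of $\mathbb{Z}^2[A]/A\mathbb{Z}^2[A]$. The digit function $\mathrm{d}:\mathbb{Z}^2[A]\to\mathcal{D}$ sends $x$ to the unique $\mathrm{d}(x)\in\mathcal{D}$ with $x-\mathrm{d}(x)\in A\mathbb{Z}^2[A]$, and $\Phi:\mathbb{Z}^2[A]\to\mathbb{Z}^2[A]$ is $\Phi(x)=A^{-1}(x-\mathrm{d}(x))$. The attractor $\mathcal{A}_\Phi$ is the smallest subset $\mathcal{S}\subseteq\mathbb{Z}^2[A]$ such that $\Phi(\mathcal{S})\subseteq\mathcal{S}$ and for every $x\in\mathbb{Z}^2[A]$ there is $k\in\mathbb{N}$ with $\Phi^k(x)\in\mathcal{S}$ (equivalently, for expanding $A$, the finite set of periodic points of $\Phi$). *)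

theory Defs
  imports "HOL-Analysis.Analysis" "HOL-Computational_Algebra.Computational_Algebra"
begin

definition eigenvalue :: "complex^'n^'n \<Rightarrow> complex \<Rightarrow> bool" where
  "eigenvalue M l \<longleftrightarrow> (\<exists>v. v \<noteq> 0 \<and> M *v v = l *s v)"

text \<open>Eigenvalues of a rational matrix are understood over the complex numbers.\<close>

definition expanding :: "rat^'n^'n \<Rightarrow> bool" where
  "expanding A \<longleftrightarrow> (\<forall>l. eigenvalue (map_matrix of_rat A) l \<longrightarrow> norm l > 1)"

definition int_lattice :: "(rat^'n) set" where
  "int_lattice = {x. \<forall>i. x $ i \<in> \<int>}"

text \<open>The set written $\mathbb{Z}^n[A]$. Powers of \<open>A\<close> are taken by iterating the map \<open>(*v) A\<close>,
  since \<open>^\<close> on the type of matrices is the componentwise power.\<close>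

definition lattice_ext :: "rat^'n^'n \<Rightarrow> (rat^'n) set" where
  "lattice_ext A =
     (\<Union>k::nat. {\<Sum>i\<le>k. ((*v) A ^^ i) (z i) | z. \<forall>i\<le>k. z i \<in> int_lattice})"

text \<open>The following definitions are meaningful when \<open>A\<close> is invertible and \<open>D\<close> is a complete
  residue system of \<open>lattice_ext A\<close> modulo \<open>A\<close> times \<open>lattice_ext A\<close>, so that the digit of each
  element of \<open>lattice_ext A\<close> exists and is unique.\<close>

definition digit :: "rat^'n^'n \<Rightarrow> (rat^'n) set \<Rightarrow> rat^'n \<Rightarrow> rat^'n" where
  "digit A D x = (THE d. d \<in> D \<and> x - d \<in> (*v) A ` lattice_ext A)"

definition digit_map :: "rat^'n^'n \<Rightarrow> (rat^'n) set \<Rightarrow> rat^'n \<Rightarrow> rat^'n" where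
  "digit_map A D x = matrix_inv A *v (x - digit A D x)"

text \<open>\<open>LEAST\<close> refers to set inclusion: the smallest set with the stated property.\<close>

definition attractor :: "rat^'n^'n \<Rightarrow> (rat^'n) set \<Rightarrow> (rat^'n) set" where
  "attractor A D =
     (LEAST S. S \<subseteq> lattice_ext A \<and> digit_map A D ` S \<subseteq> S \<and>
        (\<forall>x\<in>lattice_ext A. \<exists>k::nat. (digit_map A D ^^ k) x \<in> S))"

definition companion :: "rat \<Rightarrow> rat \<Rightarrow> rat^2^2" where
  "companion \<alpha> \<beta> = vector [vector [0, - \<beta>], vector [1, - \<alpha>]]"

definition int_vec2 :: "int \<Rightarrow> int \<Rightarrow> rat^2" where
  "int_vec2 m n = vector [of_int m, of_int n]"

definition canonical_digits :: "int \<Rightarrow> (rat^2) set" where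
  "canonical_digits b = (\<lambda>j. int_vec2 j 0) ` {0..\<bar>b\<bar> - 1}"

end

theory Submission
  imports Defs
begin

text \<open>
  Identify \<open>\<int>\<^sup>2[A]\<close> with \<open>\<int>[x]\<close> modulo \<open>c x\<^sup>2 + a x + b\<close>. Each application of \<open>\<Phi>\<close> lowers the degree of a
  representing polynomial, so every orbit enters the lattice spanned by \<open>(c, 0)\<close> and \<open>(a, c)\<close>.
  There \<open>\<Phi>\<close> is the shift \<open>(s, t) \<mapsto> (t, u)\<close>, where \<open>u\<close> is the integer with
  \<open>0 \<le> c s + a t + b u < \<bar>b\<bar>\<close>. In all five cases \<open>\<bar>a\<bar> + c \<le> \<bar>b\<bar>\<close>, hence \<open>max \<bar>s\<bar> \<bar>t\<bar>\<close> never increases,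
  every orbit is eventually periodic, and the attractor is the set of periodic points. The
  periodic integer sequences are determined by looking at their extreme values.
\<close>

section \<open>Attractors as sets of periodic points\<close>

text \<open>Minimality comes from periodicity: the orbit of a periodic point meets every invariant
  absorbing set \<open>S\<close>, stays in it, and comes back to the point.\<close>

lemma attractor_eqI:
  assumes "P \<subseteq> lattice_ext A" and "digit_map A D ` P \<subseteq> P"
    and per: "\<And>p. p \<in> P \<Longrightarrow> \<exists>n>0. (digit_map A D ^^ n) p = p"
    and reach: "\<And>x. x \<in> lattice_ext A \<Longrightarrow> \<exists>k. (digit_map A D ^^ k) x \<in> P"
  shows "attractor A D = P"
  unfolding attractor_def
proof (rule Least_equality)
  show "P \<subseteq> lattice_ext A \<and> digit_map A D ` P \<subseteq> P \<and>
      (\<forall>x\<in>lattice_ext A. \<exists>k. (digit_map A D ^^ k) x \<in> P)"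
    using assms by blast
next
  fix S
  assume S: "S \<subseteq> lattice_ext A \<and> digit_map A D ` S \<subseteq> S \<and>
      (\<forall>x\<in>lattice_ext A. \<exists>k. (digit_map A D ^^ k) x \<in> S)"
  have closed: "(digit_map A D ^^ n) x \<in> S" if "x \<in> S" for n x
    using that S by (induction n) auto
  show "P \<subseteq> S"
  proof
    fix p assume p: "p \<in> P"
    then obtain n where n: "n > 0" "(digit_map A D ^^ n) p = p" using per by blast
    obtain k where k: "(digit_map A D ^^ k) p \<in> S" using S p assms(1) by blast
    \<comment> \<open>This multiple of the period is at least \<open>k\<close>, so the return to
      \<open>p\<close> is no earlier than the visit to \<open>S\<close>.\<close>
    have "(digit_map A D ^^ (k * n)) p = p"
      by (induction k) (simp_all add: funpow_add n(2))
    moreover have "k * n = (k * n - k) + k" using n(1) by simp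
    ultimately have "(digit_map A D ^^ (k * n - k)) ((digit_map A D ^^ k) p) = p"
      by (metis funpow_add o_apply)
    then show "p \<in> S" using closed[OF k] by metis
  qed
qed

section \<open>Integer polynomials evaluated at the companion matrix\<close>

lemma companion_mult:
  "companion \<alpha> \<beta> *v x = vector [- \<beta> * x $ 2, x $ 1 - \<alpha> * x $ 2]"
  by (simp add: vec_eq_iff forall_2 companion_def matrix_vector_mult_def sum_2)

lemma int_vec2_nth [simp]: "int_vec2 m n $ 1 = of_int m" "int_vec2 m n $ 2 = of_int n"
  by (simp_all add: int_vec2_def)

lemma int_vec2_eq_iff [simp]: "int_vec2 m n = int_vec2 m' n' \<longleftrightarrow> m = m' \<and> n = n'"
  by (simp add: vec_eq_iff forall_2)

lemma int_lattice_eq: "x \<in> int_lattice \<longleftrightarrow> (\<exists>m n. x = int_vec2 m n)"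
  by (auto simp: int_lattice_def vec_eq_iff forall_2 Ints_def)

text \<open>This is p(A) applied to (1, 0), in Horner form.\<close>

definition poly_vec :: "rat^2^2 \<Rightarrow> int poly \<Rightarrow> rat^2" where
  "poly_vec A p = fold_coeffs (\<lambda>m v. int_vec2 m 0 + A *v v) p 0"

lemma int_vec2_0 [simp]: "int_vec2 0 0 = 0"
  by (simp add: vec_eq_iff forall_2)

lemma poly_vec_0 [simp]: "poly_vec A 0 = 0"
  by (simp add: poly_vec_def)

lemma poly_vec_pCons [simp]: "poly_vec A (pCons m p) = int_vec2 m 0 + A *v poly_vec A p"
  by (cases "p = 0"; cases "m = 0") (simp_all add: poly_vec_def)

lemma poly_vec_add: "poly_vec A (p + q) = poly_vec A p + poly_vec A q"
proof (induction p arbitrary: q)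
  case (pCons m p)
  show ?case
  proof (cases q)
    case (pCons n r)
    have "int_vec2 (m + n) 0 = int_vec2 m 0 + int_vec2 n 0"
      by (simp add: vec_eq_iff forall_2)
    then show ?thesis
      by (simp add: pCons pCons.IH matrix_vector_right_distrib)
  qed
qed simp

lemma poly_vec_smult: "poly_vec A (smult k p) = of_int k *s poly_vec A p"
proof (induction p)
  case (pCons m p)
  have "int_vec2 (k * m) 0 = of_int k *s int_vec2 m 0"
    by (simp add: vec_eq_iff forall_2)
  then show ?case by (simp add: pCons.IH vector_scalar_commute vector_add_ldistrib)
qed simp

lemma poly_vec_diff: "poly_vec A (p - q) = poly_vec A p - poly_vec A q"
  using poly_vec_add[of A "p - q" q] by simp

text \<open>The companion matrix sends (1, 0) to (0, 1), so linear polynomials already give the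
  whole integer lattice.\<close>

lemma poly_vec_linear: "poly_vec (companion \<alpha> \<beta>) [:m, n:] = int_vec2 m n"
  by (simp add: companion_mult vec_eq_iff forall_2)

lemma lattice_ext_mult_closed:
  fixes A :: "rat^2^2"
  assumes "x \<in> lattice_ext A"
  shows "int_vec2 m 0 + A *v x \<in> lattice_ext A"
proof -
  obtain k z where z: "x = (\<Sum>i\<le>k. ((*v) A ^^ i) (z i))" "\<forall>i\<le>k. z i \<in> int_lattice"
    using assms unfolding lattice_ext_def by auto
  have sum: "A *v (\<Sum>i\<le>n. f i) = (\<Sum>i\<le>n. A *v f i)" for f and n :: nat
    by (induction n) (simp_all add: matrix_vector_right_distrib)
  \<comment> \<open>Multiplication by \<open>A\<close> raises every power by one and frees power 0
    for the new vector.\<close>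
  define w where "w i = (case i of 0 \<Rightarrow> int_vec2 m 0 | Suc j \<Rightarrow> z j)" for i
  have "int_vec2 m 0 + A *v x = (\<Sum>i\<le>Suc k. ((*v) A ^^ i) (w i))"
    by (simp add: sum.atMost_Suc_shift w_def z(1) sum del: sum.atMost_Suc)
  moreover have "\<forall>i\<le>Suc k. w i \<in> int_lattice"
    using z(2) by (auto simp: w_def int_lattice_eq split: nat.split) 
  ultimately show ?thesis unfolding lattice_ext_def by blast
qed

text \<open>The range contains the integer lattice and is closed under addition and under
  \<open>A\<close>; conversely, Horner's rule builds every value inside
  \<open>lattice_ext\<close>.\<close>

lemma lattice_ext_companion: "lattice_ext (companion \<alpha> \<beta>) = range (poly_vec (companion \<alpha> \<beta>))"
proof
  let ?A = "companion \<alpha> \<beta>"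
  let ?R = "range (poly_vec ?A)"
  have add: "x + y \<in> ?R" if "x \<in> ?R" "y \<in> ?R" for x y
    using that by (auto simp flip: poly_vec_add)
  have pow: "((*v) ?A ^^ i) z \<in> ?R" if z: "z \<in> int_lattice" for i z
  proof (induction i)
    case 0
    then show ?case using z by (auto simp: int_lattice_eq) (metis poly_vec_linear rangeI)
  next
    case (Suc i)
    then obtain p where "((*v) ?A ^^ i) z = poly_vec ?A p" by blast
    then have "((*v) ?A ^^ Suc i) z = poly_vec ?A (pCons 0 p)" by simp
    then show ?case by blast
  qed
  have "(\<Sum>i\<le>k. ((*v) ?A ^^ i) (z i)) \<in> ?R" if "\<forall>i\<le>k. z i \<in> int_lattice" for k z
    using that
  proof (induction k)
    case 0
    then show ?case using pow[of "z 0" 0] by simp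
  next
    case (Suc k)
    then show ?case
      using add[OF _ pow[of "z (Suc k)" "Suc k"]] by (simp del: funpow.simps)
  qed
  then show "lattice_ext ?A \<subseteq> ?R" unfolding lattice_ext_def by blast
  have "0 \<in> lattice_ext ?A"
    unfolding lattice_ext_def
    by (auto intro!: exI[of _ 0] exI[of _ "\<lambda>_. 0"] simp: int_lattice_def)
  then have "poly_vec ?A p \<in> lattice_ext ?A" for p
    by (induction p) (simp_all add: lattice_ext_mult_closed)
  then show "?R \<subseteq> lattice_ext ?A" by blast
qed

section \<open>Digits through polynomials modulo \<open>c x^2 + a x + b\<close>\<close>

locale quadratic_base =
  fixes \<alpha> \<beta> :: rat and a b c :: int
  assumes c_pos: "c > 0" and a_eq: "of_int a = of_int c * \<alpha>" and b_eq: "of_int b = of_int c * \<beta>"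
    and gcd_abc: "Gcd {a, b, c} = 1" and b_nz: "b \<noteq> 0"
begin

abbreviation "A \<equiv> companion \<alpha> \<beta>"
abbreviation "\<Phi> \<equiv> digit_map A (canonical_digits b)"
abbreviation "ev \<equiv> poly_vec A"

lemma ev_min_poly: "ev [:b, a, c:] = 0"
  by (simp add: companion_mult vec_eq_iff forall_2 a_eq b_eq)

lemma ev_mult_min_poly: "ev ([:b, a, c:] * q) = 0"
proof (induction q)
  case (pCons m q)
  have "[:b, a, c:] * pCons m q = smult m [:b, a, c:] + pCons 0 ([:b, a, c:] * q)"
    by (simp add: mult.commute)
  then show ?case
    using pCons.IH ev_min_poly by (simp only: poly_vec_add poly_vec_smult poly_vec_pCons) simp
qed simp

lemma content_min_poly: "content [:b, a, c:] = 1"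
proof -
  have "content [:b, a, c:] dvd Gcd {a, b, c}"
    by (rule Gcd_greatest) (use content_dvd_coeff[of "[:b, a, c:]" 0]
        content_dvd_coeff[of "[:b, a, c:]" 1] content_dvd_coeff[of "[:b, a, c:]" 2] in
        \<open>auto simp: numeral_2_eq_2\<close>)
  then show ?thesis by (metis gcd_abc is_unit_normalize normalize_content)
qed

text \<open>Pseudo-division leaves a remainder of degree at most 1, whose value is its coefficient
  vector, so it vanishes. Gauss's lemma then removes the factor \<open>N\<close>, because
  \<open>[:b, a, c:]\<close> is primitive.\<close>

lemma ev_eq_0_imp_dvd:
  assumes "ev p = 0"
  shows "[:b, a, c:] dvd p"
proof -
  let ?C = "[:b, a, c:]"
  have C0: "?C \<noteq> 0" and dC: "degree ?C = 2" and lC: "lead_coeff ?C = c" using c_pos by auto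
  obtain q r where qr: "pseudo_divmod p ?C = (q, r)" by force
  define N where "N = c ^ (Suc (degree p) - degree ?C)"
  have N: "smult N p = ?C * q + r" and r: "r = 0 \<or> degree r < degree ?C"
    using pseudo_divmod[OF C0 qr] lC by (auto simp: N_def)
  have N0: "N \<noteq> 0" using c_pos by (simp add: N_def)
  have evr: "ev r = 0"
    using arg_cong[OF N, of ev] by (simp only: poly_vec_add poly_vec_smult ev_mult_min_poly assms) simp
  have "degree r \<le> 1" using r dC by auto
  then obtain m n where mn: "r = [:m, n:]"
    by (metis One_nat_def degree_pCons_eq_if degree_eq_zeroE le_zero_eq not_less_eq_eq pCons_cases
        pCons_0_0 Suc_le_mono)
  have "m = 0 \<and> n = 0"
    using evr unfolding mn poly_vec_linear by (simp flip: int_vec2_0)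
  then have Nq: "smult N p = ?C * q" using N mn by simp
  have "content (?C * q) = content q"
    by (simp only: content_mult content_min_poly mult_1)
  then have "N dvd content q"
    by (metis Nq content_smult dvd_mult2 dvd_triv_left normalize_dvd_iff dvd_normalize_iff dvd_refl)
  then obtain q' where "q = smult N q'"
    by (auto simp flip: const_poly_dvd_iff_dvd_content elim!: dvdE)
  then have "smult N p = smult N (?C * q')" using Nq by simp
  then have "p = ?C * q'" using N0 smult_cancel by blast
  then show ?thesis by (rule dvdI)
qed

lemma matrix_inv_companion: "matrix_inv A *v (A *v x) = x"
proof -
  have "\<beta> \<noteq> 0" using b_nz b_eq by auto
  then have "det A \<noteq> 0"
    by (simp add: det_2 companion_def)
  then have "\<exists>B. A ** B = mat 1 \<and> B ** A = mat 1"
    by (simp add: invertible_def flip: invertible_det_nz)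
  then have "matrix_inv A ** A = mat 1"
    unfolding matrix_inv_def by (metis (mono_tags, lifting) someI_ex)
  then show ?thesis by (simp add: matrix_vector_mul_assoc)
qed

text \<open>Adding \<open>u\<close> times the relation \<open>b + a x + c x^2 = 0\<close> turns the
  constant coefficient into a digit; what remains is divisible by x, and \<open>A\<close> acts as
  x.\<close>

lemma \<Phi>_ev:
  assumes "0 \<le> m + b * u" "m + b * u < \<bar>b\<bar>"
  shows "\<Phi> (ev (pCons m w)) = ev (w + smult u [:a, c:])"
proof -
  let ?d = "int_vec2 (m + b * u) 0"
  let ?y = "ev (w + smult u [:a, c:])"
  have eq: "ev (pCons m w) - ?d = A *v ?y"
  proof -
    have "pCons m w = [:m + b * u:] + pCons 0 (w + smult u [:a, c:]) - smult u [:b, a, c:]"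
      by (simp add: mult.commute)
    then have "ev (pCons m w) =
        ev ([:m + b * u:] + pCons 0 (w + smult u [:a, c:]) - smult u [:b, a, c:])" by simp
    also have "\<dots> = ev [:m + b * u:] + ev (pCons 0 (w + smult u [:a, c:]))"
      by (simp only: poly_vec_diff poly_vec_add poly_vec_smult ev_min_poly) simp
    finally show ?thesis by simp
  qed
  have "digit A (canonical_digits b) (ev (pCons m w)) = ?d"
    unfolding digit_def
  proof (rule the_equality)
    show "?d \<in> canonical_digits b \<and> ev (pCons m w) - ?d \<in> (*v) A ` lattice_ext A"
      using assms eq by (auto simp: canonical_digits_def lattice_ext_companion)
  next
    fix d assume d: "d \<in> canonical_digits b \<and> ev (pCons m w) - d \<in> (*v) A ` lattice_ext A"
    then obtain j v where j: "d = int_vec2 j 0" "0 \<le> j" "j < \<bar>b\<bar>" and v: "ev (pCons m w) - d = A *v ev v"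
      by (auto simp: canonical_digits_def lattice_ext_companion)
    \<comment> \<open>A competing digit \<open>j\<close> gives a polynomial in the kernel; its
      constant coefficient shows that \<open>j\<close> and \<open>m\<close> agree modulo
      \<open>b\<close>.\<close>
    have "ev ([:j:] + pCons 0 v - pCons m w) = 0"
      using v by (simp only: poly_vec_diff poly_vec_add j) (simp add: algebra_simps)
    then have "[:b, a, c:] dvd [:j:] + pCons 0 v - pCons m w" by (rule ev_eq_0_imp_dvd)
    then have "b dvd j - m"
      by (auto elim!: dvdE simp: dvd_def dest!: arg_cong[of _ _ "\<lambda>p. coeff p 0"])
    then have "b dvd j - (m + b * u)" by (simp add: algebra_simps dvd_diff_left_iff flip: diff_diff_eq)
    then have "\<bar>b\<bar> dvd j - (m + b * u)" by simp
    moreover have "\<bar>j - (m + b * u)\<bar> < \<bar>b\<bar>" using assms j by linarith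
    ultimately have "j = m + b * u"
      using dvd_imp_le_int[of "j - (m + b * u)" b] by auto
    then show "d = ?d" using j by simp
  qed
  then show ?thesis by (simp only: digit_map_def eq matrix_inv_companion)
qed

section \<open>The shift on the lattice spanned by (c, 0) and (a, c)\<close>

text \<open>The sign factor makes \<open>m + b * quot m\<close> equal to
  \<open>m mod \<bar>b\<bar>\<close> for either sign of \<open>b\<close>.\<close>

definition quot :: "int \<Rightarrow> int" where "quot m = - sgn b * (m div \<bar>b\<bar>)"

lemma quot: "0 \<le> m + b * quot m" "m + b * quot m < \<bar>b\<bar>"
proof -
  have "b * quot m = - (\<bar>b\<bar> * (m div \<bar>b\<bar>))"
    by (simp add: quot_def abs_sgn mult.assoc)
  then have "m + b * quot m = m mod \<bar>b\<bar>"
    by (simp add: minus_mult_div_eq_mod)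
  then show "0 \<le> m + b * quot m" "m + b * quot m < \<bar>b\<bar>" using b_nz by auto
qed

lemma quot_unique:
  assumes "0 \<le> m + b * u" "m + b * u < \<bar>b\<bar>"
  shows "quot m = u"
proof -
  have "\<bar>b * (quot m - u)\<bar> < \<bar>b\<bar>"
    using assms quot[of m] by (simp add: algebra_simps)
  then have "\<bar>b\<bar> * \<bar>quot m - u\<bar> < \<bar>b\<bar> * 1" by (simp add: abs_mult)
  then have "\<bar>quot m - u\<bar> < 1" using mult_less_cancel_left_pos[of "\<bar>b\<bar>"] b_nz by fastforce
  then show ?thesis by simp
qed

text \<open>The basis vectors (c, 0) and (a, c) represent \<open>c\<close> and
  \<open>a + c x\<close>, the truncations of \<open>b + a x + c x^2\<close> that appear when leading
  digits are carried.\<close>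

definition pt :: "int \<times> int \<Rightarrow> rat^2" where
  "pt z = int_vec2 (fst z * c + snd z * a) (snd z * c)"

definition \<tau> :: "int \<times> int \<Rightarrow> int \<times> int" where
  "\<tau> z = (snd z, quot (c * fst z + a * snd z))"

lemma pt_ev: "pt (s, t) = ev [:s * c + t * a, t * c:]"
  by (simp only: pt_def poly_vec_linear) simp

lemma inj_pt: "inj pt"
  using c_pos by (auto simp: pt_def inj_def)

lemma \<Phi>_pt: "\<Phi> (pt z) = pt (\<tau> z)"
proof (cases z)
  case (Pair s t)
  let ?u = "quot (s * c + t * a)"
  have "\<Phi> (pt (s, t)) = ev ([:t * c:] + smult ?u [:a, c:])"
    unfolding pt_ev by (rule \<Phi>_ev) (rule quot)+
  also have "\<dots> = pt (t, ?u)" unfolding pt_ev by simp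
  finally show ?thesis by (simp add: Pair \<tau>_def mult.commute)
qed

lemma \<Phi>_funpow_pt: "(\<Phi> ^^ n) (pt z) = pt ((\<tau> ^^ n) z)"
  by (induction n) (simp_all add: \<Phi>_pt)

text \<open>From degree 2 on, the correction \<open>smult u [:a, c:]\<close> has degree at most that
  of \<open>w\<close>, so each step lowers the degree. A polynomial of degree at most 1 needs two
  more steps, which replace both coefficients by carries.\<close>

lemma reaches_pt: "\<exists>k z. (\<Phi> ^^ k) (ev p) = pt z"
proof (induction "degree p" arbitrary: p rule: less_induct)
  case less
  obtain m w where p: "p = pCons m w" by (cases p)
  let ?w = "w + smult (quot m) [:a, c:]"
  have step: "\<Phi> (ev p) = ev ?w" unfolding p by (rule \<Phi>_ev) (rule quot)+
  show ?case
  proof (cases "degree p \<le> 1")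
    case False
    then have "w \<noteq> 0" "degree w \<ge> 1" using p by (auto split: if_splits)
    then have "degree ?w < degree p"
      using p False by (intro degree_add_less) (auto intro: le_less_trans[OF degree_smult_le])
    then obtain k z where "(\<Phi> ^^ k) (ev ?w) = pt z" using less by blast
    then have "(\<Phi> ^^ Suc k) (ev p) = pt z" by (simp only: funpow_Suc_right o_apply step)
    then show ?thesis by blast
  next
    case True
    then have "degree w = 0" using p by (auto split: if_splits)
    then obtain n where n: "w = [:n:]" by (rule degree_eq_zeroE)
    let ?u = "quot m" and ?v = "quot (n + quot m * a)"
    have "?w = pCons (n + ?u * a) [:?u * c:]" using n by simp
    then have "\<Phi> (\<Phi> (ev p)) = ev ([:?u * c:] + smult ?v [:a, c:])"
      unfolding step by (simp only:) (rule \<Phi>_ev; rule quot)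
    also have "\<dots> = pt (?u, ?v)" unfolding pt_ev by simp
    finally have "(\<Phi> ^^ 2) (ev p) = pt (?u, ?v)" by (simp add: numeral_2_eq_2)
    then show ?thesis by blast
  qed
qed

section \<open>Periodic points of the shift\<close>

definition periodic :: "(int \<times> int) set" where
  "periodic = {z. \<exists>n>0. (\<tau> ^^ n) z = z}"

text \<open>A digit is strictly below \<open>\<bar>b\<bar>\<close>, so the new entry has modulus
  strictly below \<open>M + 1\<close>; integrality gives \<open>M\<close>.\<close>

lemma \<tau>_bound:
  assumes "\<bar>a\<bar> + c \<le> \<bar>b\<bar>" "\<bar>fst z\<bar> \<le> M" "\<bar>snd z\<bar> \<le> M"
  shows "\<bar>fst (\<tau> z)\<bar> \<le> M \<and> \<bar>snd (\<tau> z)\<bar> \<le> M"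
proof -
  let ?x = "c * fst z + a * snd z"
  have "\<bar>?x\<bar> \<le> c * M + \<bar>a\<bar> * M"
    using assms(2,3) c_pos
    by (intro order_trans[OF abs_triangle_ineq] add_mono) (auto simp: abs_mult intro!: mult_left_mono)
  also have "\<dots> \<le> \<bar>b\<bar> * M"
    using mult_right_mono[OF assms(1), of M] assms(2) by (simp add: algebra_simps)
  finally have "\<bar>b * quot ?x\<bar> < \<bar>b\<bar> * (M + 1)"
    using quot[of ?x] by (simp add: algebra_simps)
  then have "\<bar>b\<bar> * \<bar>quot ?x\<bar> < \<bar>b\<bar> * (M + 1)" by (simp add: abs_mult)
  then have "\<bar>quot ?x\<bar> < M + 1" using b_nz by (simp add: mult_less_cancel_left_pos)
  then show ?thesis using assms(3) by (simp add: \<tau>_def)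
qed

text \<open>The orbit stays in a finite box, so the pigeonhole principle yields a
  repetition.\<close>

lemma reaches_periodic:
  assumes "\<bar>a\<bar> + c \<le> \<bar>b\<bar>"
  shows "\<exists>k. (\<tau> ^^ k) z \<in> periodic"
proof -
  define M where "M = max \<bar>fst z\<bar> \<bar>snd z\<bar>"
  have "\<bar>fst ((\<tau> ^^ k) z)\<bar> \<le> M \<and> \<bar>snd ((\<tau> ^^ k) z)\<bar> \<le> M" for k
    by (induction k) (use \<tau>_bound[OF assms] in \<open>auto simp: M_def\<close>)
  then have "range (\<lambda>k. (\<tau> ^^ k) z) \<subseteq> {-M..M} \<times> {-M..M}"
    by (simp only: image_subset_iff mem_Times_iff atLeastAtMost_iff abs_le_iff) (metis minus_le_iff)
  then have "finite (range (\<lambda>k. (\<tau> ^^ k) z))" by (rule finite_subset) simp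
  then have "\<not> inj (\<lambda>k. (\<tau> ^^ k) z)" using finite_imageD infinite_UNIV_nat by blast
  then obtain i j where "i \<noteq> j" "(\<tau> ^^ i) z = (\<tau> ^^ j) z" by (auto simp: inj_def)
  then obtain i j where ij: "i < j" "(\<tau> ^^ i) z = (\<tau> ^^ j) z" by (metis nat_neq_iff)
  have "(\<tau> ^^ (j - i)) ((\<tau> ^^ i) z) = (\<tau> ^^ (j - i + i)) z" by (simp only: funpow_add o_apply)
  then have "(\<tau> ^^ (j - i)) ((\<tau> ^^ i) z) = (\<tau> ^^ i) z" using ij by simp
  then have "(\<tau> ^^ i) z \<in> periodic"
    using ij(1) unfolding periodic_def by (intro CollectI exI[of _ "j - i"]) simp
  then show ?thesis by blast
qed

lemma attractor_eq:
  assumes "\<bar>a\<bar> + c \<le> \<bar>b\<bar>"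
  shows "attractor A (canonical_digits b) = pt ` periodic"
proof (rule attractor_eqI)
  show "pt ` periodic \<subseteq> lattice_ext A"
    unfolding lattice_ext_companion by clarify (simp only: pt_ev rangeI)
  have "\<tau> z \<in> periodic" if "z \<in> periodic" for z
    using that unfolding periodic_def by (auto simp: funpow_swap1[symmetric])
  then show "\<Phi> ` pt ` periodic \<subseteq> pt ` periodic"
    by (auto simp: \<Phi>_pt)
  show "\<exists>n>0. (\<Phi> ^^ n) p = p" if "p \<in> pt ` periodic" for p
    using that by (auto simp: periodic_def \<Phi>_funpow_pt)
  fix x assume "x \<in> lattice_ext A"
  then obtain k z where k: "(\<Phi> ^^ k) x = pt z"
    unfolding lattice_ext_companion using reaches_pt by blast
  obtain l where "(\<tau> ^^ l) z \<in> periodic" using reaches_periodic[OF assms] by blast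
  then have "(\<Phi> ^^ (l + k)) x \<in> pt ` periodic" by (simp add: funpow_add k \<Phi>_funpow_pt)
  then show "\<exists>k. (\<Phi> ^^ k) x \<in> pt ` periodic" by blast
qed

text \<open>Turns a periodic point into an integer sequence whose windows of length three give
  digits. Finite range provides extreme values; recurrence at arbitrarily late indices allows
  tracing back from any entry.\<close>

lemma periodicE:
  assumes "z \<in> periodic"
  obtains t :: "nat \<Rightarrow> int" where "z = (t 0, t 1)" "finite (range t)" "\<And>i k. \<exists>j. t (j + k) = t i"
    "\<And>i. 0 \<le> c * t i + a * t (i + 1) + b * t (i + 2)"
    "\<And>i. c * t i + a * t (i + 1) + b * t (i + 2) < \<bar>b\<bar>"
proof -
  obtain N where N: "N > 0" "(\<tau> ^^ N) z = z" using assms by (auto simp: periodic_def)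
  define t where "t i = fst ((\<tau> ^^ i) z)" for i
  have eq: "(\<tau> ^^ i) z = (t i, t (i + 1))" for i
    by (simp add: t_def prod_eq_iff) (simp add: \<tau>_def)
  have "t (i + 2) = quot (c * t i + a * t (i + 1))" for i
    using eq[of "Suc i"] eq[of i] by (simp add: \<tau>_def)
  then have "0 \<le> c * t i + a * t (i + 1) + b * t (i + 2)"
    "c * t i + a * t (i + 1) + b * t (i + 2) < \<bar>b\<bar>" for i
    using quot[of "c * t i + a * t (i + 1)"] by simp_all
  moreover have per: "t (i + N * k) = t i" for i k
  proof (induction k)
    case (Suc k)
    have "t (i + N) = t i" for i by (simp add: t_def funpow_add N)
    from this[of "i + N * k"] show ?case by (simp add: Suc.IH algebra_simps)
  qed simp
  moreover have "range t \<subseteq> t ` {..<N}"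
  proof
    fix x assume "x \<in> range t"
    then obtain i where "x = t i" by blast
    then have "x = t (i mod N)" using per[of "i mod N" "i div N"] by simp
    then show "x \<in> t ` {..<N}" using N(1) by simp
  qed
  then have "finite (range t)" by (rule finite_subset) simp
  moreover have "\<exists>j. t (j + k) = t i" for i k
  proof -
    have "k \<le> N * k" using N(1) by simp
    then have "i + (N * k - k) + k = i + N * k" by linarith
    then show ?thesis using per[of i k] by metis
  qed
  moreover have "z = (t 0, t 1)" using eq[of 0] by simp
  ultimately show ?thesis using that by blast
qed

lemma \<tau>_eqI:
  assumes "0 \<le> c * s + a * t + b * u" "c * s + a * t + b * u < \<bar>b\<bar>"
  shows "\<tau> (s, t) = (t, u)"
  using quot_unique[OF assms] by (simp add: \<tau>_def)

lemma diagonal_periodic: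
  assumes "0 \<le> k * (a + b + c)" "k * (a + b + c) < \<bar>b\<bar>"
  shows "(k, k) \<in> periodic"
proof -
  have "\<tau> (k, k) = (k, k)" using assms by (intro \<tau>_eqI) (simp_all add: algebra_simps)
  then show ?thesis unfolding periodic_def by (auto intro!: exI[of _ 1])
qed


section \<open>Periodic sequences for the different signs of \<open>a\<close> and
  \<open>b\<close>\<close>

text \<open>An entry of maximal modulus \<open>B\<close> at the end of a window must be compensated
  by its predecessors. As digits lie between 0 and \<open>b - 1\<close>, an end \<open>- B\<close>
  forces both predecessors, an end \<open>B\<close> only one of them.\<close>

lemma periodic_pos:
  assumes "a > 0" "a + c \<le> b"
  shows "periodic = {(0, 0)}"
proof -
  have "z = (0, 0)" if "z \<in> periodic" for z
    using that
  proof (rule periodicE)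
    fix t :: "nat \<Rightarrow> int"
    assume z: "z = (t 0, t 1)" and fin: "finite (range t)" and rec: "\<And>i k. \<exists>j. t (j + k) = t i"
      and lo: "\<And>i. 0 \<le> c * t i + a * t (i + 1) + b * t (i + 2)"
      and "\<And>i. c * t i + a * t (i + 1) + b * t (i + 2) < \<bar>b\<bar>"
    then have hi: "c * t i + a * t (i + 1) + b * t (i + 2) < b" for i
      using assms c_pos by simp
    define B where "B = Max (range (\<lambda>i. \<bar>t i\<bar>))"
    have fin': "finite (range (\<lambda>i. \<bar>t i\<bar>))"
      using finite_imageI[OF fin, of abs] by (simp add: image_image)
    have le: "\<bar>t i\<bar> \<le> B" for i unfolding B_def using fin' by (intro Max_ge) auto
    have "B \<in> range (\<lambda>i. \<bar>t i\<bar>)" unfolding B_def using fin' by (intro Max_in) auto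
    then obtain p where p: "\<bar>t p\<bar> = B" by auto
    have "B \<le> 0"
    proof (rule ccontr)
      assume "\<not> B \<le> 0"
      then have B: "B \<ge> 1" by simp
      have scale: "(a + c) * x \<le> b * x" if "x \<ge> 0" for x
        using assms(2) that by (rule mult_right_mono)
      \<comment> \<open>Tracing back from an entry \<open>- B\<close> forces the block \<open>B, - B, B, B\<close>; its two windows add up
        to \<open>2 b B < 2 b\<close>.\<close>
      have pos: "t i = - B \<or> t (i + 1) = - B" if "t (i + 2) = B" for i
      proof (rule ccontr)
        assume "\<not> ?thesis"
        \<comment> \<open>The window would be at least \<open>b * B - (a + c) * (B - 1)\<close>,
          hence at least \<open>b\<close>.\<close>
        then have "t i \<ge> - (B - 1)" "t (i + 1) \<ge> - (B - 1)"
          using le[of i] le[of "i + 1"] by linarith+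
        then have "c * t i \<ge> c * - (B - 1)" "a * t (i + 1) \<ge> a * - (B - 1)"
          using c_pos assms(1) by (auto intro!: mult_left_mono simp del: mult_minus_right)
        then show False using hi[of i] that scale[of "B - 1"] B by (simp add: algebra_simps)
      qed
      have neg: "t i = B \<and> t (i + 1) = B" if "t (i + 2) = - B" for i
      proof -
        have "c * t i \<le> c * B" "a * t (i + 1) \<le> a * B"
          using le[of i] le[of "i + 1"] c_pos assms(1) by (auto intro!: mult_left_mono)
        moreover have "c * t i + a * t (i + 1) \<ge> c * B + a * B"
          using lo[of i] that scale[of B] B by (simp add: algebra_simps)
        ultimately have "c * t i = c * B" "a * t (i + 1) = a * B" by linarith+
        then show ?thesis using c_pos assms(1) by simp
      qed
      have "\<exists>q. t q = - B"
      proof -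
        obtain q where "t (q + 2) = t p" using rec by blast
        then show ?thesis using p pos[of q] by (metis abs_eq_iff' B p abs_of_pos minus_minus)
      qed
      \<comment> \<open>Offset 5 is what the tracing consumes: from \<open>i + 5\<close> to
        \<open>i + 3\<close> and \<open>i + 4\<close>, then to \<open>i + 2\<close>, then to
        \<open>i\<close> and \<open>i + 1\<close>.\<close>
      then obtain i where i: "t (i + 5) = - B" using rec by metis
      have "t (i + 3) = B" "t (i + 4) = B" using neg[of "i + 3"] i by (simp_all add: eval_nat_numeral)
      moreover from this have "t (i + 2) = - B" using pos[of "i + 2"] B by (simp add: eval_nat_numeral)
      moreover from this have "t (i + 1) = B" using neg[of i] by simp
      ultimately have "c * B + a * - B + b * B < b" "c * - B + a * B + b * B < b"
        using hi[of "i + 1"] hi[of "i + 2"] by (simp_all add: eval_nat_numeral)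
      then have "b * (B - 1) < 0" by (simp add: algebra_simps)
      moreover have "0 \<le> b * (B - 1)" using assms c_pos B by simp
      ultimately show False by simp
    qed
    then have "t i = 0" for i using le[of i] by simp
    then show "z = (0, 0)" using z by simp
  qed
  moreover have "(0, 0) \<in> periodic" using diagonal_periodic[of 0] b_nz by simp
  ultimately show ?thesis by blast
qed

text \<open>Comparing minimum and maximum excludes negative entries. A nonnegative sequence cannot
  rise after its first entry, and recurrence then makes it constant.\<close>

lemma periodic_neg:
  assumes "a < 0" "c - a < b"
  shows "periodic = {(k, k) | k. 0 \<le> k \<and> k * (a + b + c) \<le> b - 1}"
proof -
  have "\<exists>k. z = (k, k) \<and> 0 \<le> k \<and> k * (a + b + c) \<le> b - 1" if "z \<in> periodic" for z
    using that
  proof (rule periodicE)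
    fix t :: "nat \<Rightarrow> int"
    assume z: "z = (t 0, t 1)" and fin: "finite (range t)" and rec: "\<And>i k. \<exists>j. t (j + k) = t i"
      and lo: "\<And>i. 0 \<le> c * t i + a * t (i + 1) + b * t (i + 2)"
      and "\<And>i. c * t i + a * t (i + 1) + b * t (i + 2) < \<bar>b\<bar>"
    then have hi: "c * t i + a * t (i + 1) + b * t (i + 2) < b" for i
      using assms c_pos by simp
    define M m where "M = Max (range t)" and "m = Min (range t)"
    have le: "t i \<le> M" and ge: "m \<le> t i" for i
      unfolding M_def m_def using fin by (auto intro: Max_ge Min_le)
    have "M \<in> range t" "m \<in> range t"
      unfolding M_def m_def using fin by (auto intro!: Max_in Min_in)
    then obtain p q where p: "t p = M" and q: "t q = m" by auto
    have "m \<ge> 0"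
    proof (rule ccontr)
      assume "\<not> m \<ge> 0"
      then have m: "m < 0" by simp
      \<comment> \<open>Otherwise a window ending in \<open>m\<close> is at most
        \<open>(b + a - c) * m\<close>, which is negative.\<close>
      have M: "- m < M"
      proof (rule ccontr)
        assume "\<not> ?thesis"
        obtain i where i: "t (i + 2) = m" using rec[where i = q and k = 2] q by auto
        have "c * t i \<le> c * M" "c * M \<le> c * - m" "(- a) * m \<le> (- a) * t (i + 1)"
          using le[of i] ge[of "i + 1"] c_pos assms(1) \<open>\<not> - m < M\<close>
          by (auto intro!: mult_left_mono simp del: mult_minus_left mult_minus_right)
        then have "0 \<le> (b + a - c) * m" using lo[of i] i by (simp add: algebra_simps)
        moreover have "(b + a - c) * m < 0" using m assms by (intro mult_pos_neg) auto
        ultimately show False by simp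
      qed
      \<comment> \<open>If \<open>M\<close> were always preceded by \<open>M\<close>, it would
        propagate back to an occurrence of \<open>m\<close>.\<close>
      have "\<exists>i. t (i + 2) = M \<and> t (i + 1) \<noteq> M"
      proof (rule ccontr)
        assume *: "\<not> ?thesis"
        obtain l where l: "t (l + 1) = m" using rec q by metis
        have "t (l + 1) = M" if "t (k + (l + 1)) = M" for k
          using that
        proof (induction k)
          case (Suc k)
          then have "t (k + l + 2) = M" by simp
          then have "t (k + l + 1) = M" using * by blast
          then show ?case using Suc.IH by simp
        qed simp
        moreover obtain k where "t (k + (l + 1)) = M" using rec p by metis
        ultimately show False using l m M by simp
      qed
      then obtain i where i: "t (i + 2) = M" "t (i + 1) \<noteq> M" by blast
      \<comment> \<open>Both \<open>t (i + 1)\<close> and \<open>- t i\<close> are at most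
        \<open>M - 1\<close>, so the window is at least \<open>b * M - (c - a) * (M - 1)\<close>,
        hence at least \<open>b\<close>.\<close>
      have "t (i + 1) \<le> M - 1" using le[of "i + 1"] i by simp
      then have "(- a) * t (i + 1) \<le> (- a) * (M - 1)"
        using assms(1) by (intro mult_left_mono) auto
      moreover have "- t i \<le> M - 1" using ge[of i] M by linarith
      then have "c * - t i \<le> c * (M - 1)" using c_pos by (intro mult_left_mono) auto
      moreover have "(c - a) * (M - 1) \<le> b * (M - 1)"
        using assms(2) m M by (intro mult_right_mono) auto
      ultimately show False using hi[of i] i by (simp add: algebra_simps)
    qed
    then have nonneg: "t i \<ge> 0" for i using ge[of i] by simp
    \<comment> \<open>A rise by at least 1 makes the window at least
      \<open>c * t i + (a + b) * t (i + 1) + b\<close>, which reaches \<open>b\<close>.\<close>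
    have decr: "t (i + 2) \<le> t (i + 1)" for i
    proof (rule ccontr)
      assume "\<not> ?thesis"
      then have "b * (t (i + 1) + 1) \<le> b * t (i + 2)"
        using assms c_pos by (intro mult_left_mono) auto
      moreover have "0 \<le> (a + b) * t (i + 1)" "0 \<le> c * t i"
        using nonneg assms c_pos by (auto intro!: mult_nonneg_nonneg)
      ultimately show False using hi[of i] by (simp add: algebra_simps)
    qed
    have anti: "t (i + k + 1) \<le> t (i + 1)" for i k
    proof (induction k)
      case (Suc k)
      then show ?case using decr[of "i + k"] by simp
    qed simp
    have const: "t (i + 1) = t 1" for i
    proof (rule antisym)
      show "t (i + 1) \<le> t 1" using anti[of 0 i] by simp
      obtain j where "t (j + (i + 1)) = t 1" using rec by blast
      then show "t 1 \<le> t (i + 1)" using anti[of i j] by (simp add: add.commute add.left_commute)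
    qed
    \<comment> \<open>Index 0 ends no window, so \<open>t 0\<close> is compared through a later
      occurrence of its value.\<close>
    moreover obtain j where "t (j + 1) = t 0" using rec by blast
    ultimately have "t 0 = t 1" by metis
    then have "t 1 * (a + b + c) \<le> b - 1" "z = (t 1, t 1)"
      using hi[of 0] const[of 1] z by (simp_all add: algebra_simps)
    then show ?thesis using nonneg by blast
  qed
  moreover have "(k, k) \<in> periodic" if "0 \<le> k" "k * (a + b + c) \<le> b - 1" for k
    using that assms c_pos by (intro diagonal_periodic) auto
  ultimately show ?thesis by blast
qed

text \<open>The sequence alternating between 0 and -1 has windows \<open>- a\<close> and
  \<open>- c - b\<close>, both valid digits.\<close>

lemma two_cycle_periodic:
  assumes "a < 0" "- a + c < - b"
  shows "(0, -1) \<in> periodic" "(-1, 0) \<in> periodic"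
proof -
  have "\<tau> (0, -1) = (-1, 0)" "\<tau> (-1, 0) = (0, -1)"
    using assms c_pos by (auto intro!: \<tau>_eqI)
  then show "(0, -1) \<in> periodic" "(-1, 0) \<in> periodic"
    unfolding periodic_def by (auto intro!: exI[of _ 2] simp: numeral_2_eq_2)
qed

end

section \<open>The largest \<open>K\<close>, and the five cases\<close>

text \<open>The candidates for \<open>K\<close> are bounded by \<open>n\<close> and include 1
  because \<open>m \<le> n\<close>, so \<open>GREATEST\<close> is a true maximum; multiples of a
  positive \<open>m\<close> are monotone.\<close>

lemma atLeastAtMost_Greatest_mult:
  fixes m n :: int
  assumes "0 < m" "m \<le> n"
  shows "{0..(GREATEST K. 0 < K \<and> K * m \<le> n)} = {k. 0 \<le> k \<and> k * m \<le> n}"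
proof -
  let ?S = "{K. 0 < K \<and> K * m \<le> n}"
  have "K \<le> n" if "K \<in> ?S" for K
  proof -
    have "K * 1 \<le> K * m" using that assms by (intro mult_left_mono) auto
    also have "\<dots> \<le> n" using that by simp
    finally show ?thesis by simp
  qed
  then have "?S \<subseteq> {0..n}" by auto
  then have fin: "finite ?S" by (rule finite_subset) simp
  moreover have "1 \<in> ?S" using assms by simp
  ultimately have Max: "Max ?S \<in> ?S" by (intro Max_in) blast+
  have "(GREATEST K. 0 < K \<and> K * m \<le> n) = Max ?S"
    using Max fin by (intro Greatest_equality) auto
  moreover have "k * m \<le> n" if "0 \<le> k" "k \<le> Max ?S" for k
  proof -
    have "k * m \<le> Max ?S * m" using that assms by (intro mult_right_mono) auto
    also have "\<dots> \<le> n" using Max by simp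
    finally show ?thesis .
  qed
  moreover have "k \<le> Max ?S" if "0 \<le> k" "k * m \<le> n" for k
    using that Max fin by (cases "k = 0") auto
  ultimately show ?thesis by auto
qed

theorem theorem3p3:
  fixes \<alpha> \<beta> :: rat and a b c :: int
  assumes "irreducible [:\<beta>, \<alpha>, 1:]"
    and "expanding (companion \<alpha> \<beta>)"
    and "c > 0" and "of_int a = of_int c * \<alpha>" and "of_int b = of_int c * \<beta>"
    and "Gcd {a, b, c} = 1"
  defines "\<A> \<equiv> attractor (companion \<alpha> \<beta>) (canonical_digits b)"
  shows "(0 < \<alpha> \<and> \<alpha> \<le> \<beta> - 1 \<longrightarrow> \<A> = {0})
    \<and> (0 < - \<alpha> \<and> - \<alpha> < \<beta> - 1 \<and> \<alpha> < - 1 \<longrightarrow>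
        (let K = (GREATEST K::int. 0 < K \<and> K * (a + b + c) \<le> b - 1)
         in \<A> = (\<lambda>k. int_vec2 (k * (a + c)) (k * c)) ` {0..K}))
    \<and> (0 < - \<alpha> \<and> - \<alpha> < \<beta> - 1 \<and> \<alpha> \<ge> - 1 \<longrightarrow> \<A> = {0})
    \<and> (0 < - \<alpha> \<and> - \<alpha> < - \<beta> - 1 \<longrightarrow>
        {int_vec2 0 0, int_vec2 (- a) (- c), int_vec2 (- c) 0} \<subseteq> \<A>)
    \<and> (0 < \<alpha> \<and> \<alpha> < - \<beta> - 1 \<longrightarrow>
        (let K = (GREATEST K::int. 0 < K \<and> K * (- a - b - c) \<le> - b - 1)
         in (\<lambda>k. int_vec2 (- (k * (a + c))) (- (k * c))) ` {0..K} \<subseteq> \<A>))"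
proof -
  note c = \<open>c > 0\<close>
  \<comment> \<open>Multiplying by the positive \<open>c\<close> turns conditions on
    \<open>\<alpha>\<close> and \<open>\<beta>\<close> into integer inequalities in
    \<open>a\<close>, \<open>b\<close>, \<open>c\<close>.\<close>
  have lin: "x * \<alpha> + y * \<beta> + z = of_int (k * a + l * b + n * c) / of_int c"
    if "x = of_int k" "y = of_int l" "z = of_int n" for x y z :: rat and k l n :: int
    using c that assms(4,5) by (simp add: field_simps)
  have less: "0 < of_int k * \<alpha> + of_int l * \<beta> + of_int n \<longleftrightarrow> 0 < k * a + l * b + n * c" for k l n
    using c lin[OF refl refl refl, of k l n] by (simp only: zero_less_divide_iff of_int_0_less_iff) auto
  have le: "0 \<le> of_int k * \<alpha> + of_int l * \<beta> + of_int n \<longleftrightarrow> 0 \<le> k * a + l * b + n * c" for k l n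
    using c lin[OF refl refl refl, of k l n] by (simp only: zero_le_divide_iff of_int_0_le_iff) auto
  have iff: "0 < \<alpha> \<longleftrightarrow> 0 < a" "0 < - \<alpha> \<longleftrightarrow> a < 0" "\<alpha> \<le> \<beta> - 1 \<longleftrightarrow> a + c \<le> b"
    "- \<alpha> < \<beta> - 1 \<longleftrightarrow> c - a < b" "\<alpha> < - 1 \<longleftrightarrow> a + c < 0" "\<alpha> \<ge> - 1 \<longleftrightarrow> 0 \<le> a + c"
    "- \<alpha> < - \<beta> - 1 \<longleftrightarrow> - a + c < - b" "\<alpha> < - \<beta> - 1 \<longleftrightarrow> a + c < - b"
    using less[of 1 0 0] less[of "-1" 0 0] le[of "-1" 1 "-1"] less[of 1 1 "-1"] less[of "-1" 0 "-1"]
      le[of 1 0 1] less[of 1 "-1" "-1"] less[of "-1" "-1" "-1"]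
    by (simp_all add: algebra_simps) linarith+
  have base: "quadratic_base \<alpha> \<beta> a b c" if "b \<noteq> 0"
    using assms that by unfold_locales
  note attractor = quadratic_base.attractor_eq[OF base, folded \<A>_def]
  note pt = quadratic_base.pt_def[OF base]
  have diag: "quadratic_base.pt a c (k, k) = int_vec2 (k * (a + c)) (k * c)" if "b \<noteq> 0" for k
    using pt[OF that] by (simp add: algebra_simps)
  have 1: "\<A> = {0}" if "0 < a" "a + c \<le> b"
    using that c attractor quadratic_base.periodic_pos[OF base] pt by simp
  \<comment> \<open>Cases 2 and 3 share this description; the sign of \<open>a + c\<close> decides
    whether a positive \<open>k\<close> satisfies the bound.\<close>
  have eq: "\<A> = (\<lambda>k. int_vec2 (k * (a + c)) (k * c)) ` {k. 0 \<le> k \<and> k * (a + b + c) \<le> b - 1}"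
    if "a < 0" "c - a < b"
  proof -
    have "b \<noteq> 0" using that c by auto
    moreover have "{(k, k) | k. P k} = (\<lambda>k. (k, k)) ` {k. P k}" for P :: "int \<Rightarrow> bool" by blast
    ultimately show ?thesis
      using that c attractor quadratic_base.periodic_neg[OF base] by (simp add: image_image diag)
  qed
  have 2: "\<A> = (\<lambda>k. int_vec2 (k * (a + c)) (k * c)) ` {0..(GREATEST K. 0 < K \<and> K * (a + b + c) \<le> b - 1)}"
    if "a < 0" "c - a < b" "a + c < 0"
    using that c eq atLeastAtMost_Greatest_mult[of "a + b + c" "b - 1"] by simp
  have 3: "\<A> = {0}" if *: "a < 0" "c - a < b" "0 \<le> a + c"
  proof -
    have "k = 0" if "0 \<le> k" "k * (a + b + c) \<le> b - 1" for k
    proof (rule ccontr)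
      assume "k \<noteq> 0"
      then have "1 * (a + b + c) \<le> k * (a + b + c)"
        using that * c by (intro mult_right_mono) auto
      also have "\<dots> \<le> b - 1" by (rule that)
      finally show False using * by simp
    qed
    then have "{k. 0 \<le> k \<and> k * (a + b + c) \<le> b - 1} = {0}" using * c by auto
    then show ?thesis using eq[OF *(1,2)] by simp
  qed
  have 4: "{int_vec2 0 0, int_vec2 (- a) (- c), int_vec2 (- c) 0} \<subseteq> \<A>" if "a < 0" "- a + c < - b"
  proof -
    have b: "b \<noteq> 0" and att: "\<A> = quadratic_base.pt a c ` quadratic_base.periodic a b c"
      using that c attractor by auto
    \<comment> \<open>Under \<open>pt\<close>, the 2-cycle points (0, -1) and (-1, 0) become -(a, c)
      and -(c, 0).\<close>
    have "quadratic_base.pt a c z \<in> \<A>" if "z \<in> {(0, 0), (0, -1), (-1, 0)}" for z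
      using that quadratic_base.diagonal_periodic[OF base[OF b], of 0] b
        quadratic_base.two_cycle_periodic[OF base[OF b] \<open>a < 0\<close> \<open>- a + c < - b\<close>]
      unfolding att by auto
    from this[of "(0, 0)"] this[of "(0, -1)"] this[of "(-1, 0)"] show ?thesis
      by (simp add: pt[OF b])
  qed
  have 5: "(\<lambda>k. int_vec2 (- (k * (a + c))) (- (k * c))) `
      {0..(GREATEST K. 0 < K \<and> K * (- a - b - c) \<le> - b - 1)} \<subseteq> \<A>" if "0 < a" "a + c < - b"
  proof -
    have b: "b \<noteq> 0" and att: "\<A> = quadratic_base.pt a c ` quadratic_base.periodic a b c"
      using that c attractor by auto
    have "int_vec2 (- (k * (a + c))) (- (k * c)) \<in> \<A>"
      if "0 \<le> k" "k * (- a - b - c) \<le> - b - 1" for k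
    proof -
      have "0 \<le> k * (- a - b - c)"
        using that(1) \<open>a + c < - b\<close> by (intro mult_nonneg_nonneg) auto
      \<comment> \<open>Here \<open>a + b + c\<close> is negative, so the constant sequences with
        nonnegative windows are those with entries \<open>- k\<close>.\<close>
      then have "(- k, - k) \<in> quadratic_base.periodic a b c"
        using that \<open>0 < a\<close> \<open>a + c < - b\<close> c
        by (intro quadratic_base.diagonal_periodic[OF base[OF b]]) (simp_all add: algebra_simps)
      then show ?thesis using diag[OF b, of "- k"] unfolding att by (metis image_eqI mult_minus_left)
    qed
    then show ?thesis using that c atLeastAtMost_Greatest_mult[of "- a - b - c" "- b - 1"] by auto
  qed
  show ?thesis
    unfolding iff Let_def
    by (intro conjI impI; elim conjE) (rule 1 2 3 4 5; assumption)+
qed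

end
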